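(* Let $p\in[1,\infty)$. Then $[\mathcal H^\infty_{v\mathcal N^p},\|\cdot\|_{\mathcal H^\infty_{v\mathcal N^p}}]\le[\mathcal H^\infty_{v\mathcal K_p},\|\cdot\|_{\mathcal H^\infty_{v\mathcal K_p}}]$; that is, for every complex Banach space $E$, every open $U\subseteq E$, every weight $v$ on $U$ and every complex Banach space $F$, one has $\mathcal H^\infty_{v\mathcal N^p}(U,F)\subseteq\mathcal H^\infty_{v\mathcal K_p}(U,F)$ and $\|f\|_{\mathcal H^\infty_{v\mathcal K_p}}\le\|f\|_{\mathcal H^\infty_{v\mathcal N^p}}$ for all $f\in\mathcal H^\infty_{v\mathcal N^p}(U,F)$.
   Context: A weight on $U$ is a strictly positive continuous function. $\mathcal H_v^\infty(U,F)$ is the Banach space of holomorphic $f\colon U\to F$ with $\|f\|_v:=\sup_{x\in U}v(x)\|f(x)\|<\infty$; $\mathcal H_v^\infty(U):=\mathcal H_v^\infty(U,\mathbb C)$. $p^*$ is the conjugate index of $p$. For a Banach space $X$, $\ell_p(X)$ is the space of sequences with $\|(x_n)\|_p=(\sum\|x_n\|^p)^{1/p}<\infty$, and $\ell_q^w(X)$ of those with $\|(x_n)\|_q^w=\sup_{x^*\in B_{X^*}}\|(x^*(x_n))\|_q<\infty$ (for $q=\infty$ this is the space of bounded sequences with the supremum norm). A mapping $f\in\mathcal H_v^\infty(U,F)$ is right $p$-nuclear, $f\in\mathcal H^\infty_{v\mathcal N^p}(U,F)$, if there are $(g_n)\in\ell_{p^*}^w(\mathcal H_v^\infty(U))$ and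 $(y_n)\in\ell_p(F)$ with $f=\sum_{n=1}^\infty g_n\cdot y_n$ in $(\mathcal H_v^\infty(U,F),\|\cdot\|_v)$, where $(g\cdot y)(x)=g(x)y$; $\|f\|_{\mathcal H^\infty_{v\mathcal N^p}}=\inf\|(g_n)\|_{p^*}^w\|(y_n)\|_p$ over all such representations. For $(x_n)\in\ell_p(X)$, $p\text{-}\mathrm{conv}(x_n)=\{\sum_n a_nx_n:(a_n)\in B\}$, where $B=B_{\ell_{p^*}}$ if $1<p<\infty$ and $B=B_{c_0}$ if $p=1$. A set $K\subseteq X$ is relatively $p$-compact if $K\subseteq p\text{-}\mathrm{conv}(x_n)$ for some $(x_n)\in\ell_p(X)$, and $m_{\mathcal K_p}(K)$ is the infimum of $\|(x_n)\|_p$ over all such sequences. $\mathcal H^\infty_{v\mathcal K_p}(U,F)$ is the set of $f\in\mathcal H_v^\infty(U,F)$ such that $(vf)(U)=\{v(x)f(x):x\in U\}$ is relatively $p$-compact, with $\|f\|_{\mathcal H^\infty_{v\mathcal K_p}}=m_{\mathcal K_p}((vf)(U))$. *)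

theory Defs
  imports "HOL-Analysis.Analysis"
begin

class complex_normed_vector = real_normed_vector +
  fixes scaleC :: "complex \<Rightarrow> 'a \<Rightarrow> 'a"  (infixr \<open>*\<^sub>C\<close> 75)
  assumes scaleC_add_right: "a *\<^sub>C (x + y) = a *\<^sub>C x + a *\<^sub>C y"
    and scaleC_add_left: "(a + b) *\<^sub>C x = a *\<^sub>C x + b *\<^sub>C x"
    and scaleC_scaleC: "a *\<^sub>C (b *\<^sub>C x) = (a * b) *\<^sub>C x"
    and scaleC_of_real: "complex_of_real r *\<^sub>C x = r *\<^sub>R x"
    and norm_scaleC: "norm (a *\<^sub>C x) = cmod a * norm x"

class complex_banach = complex_normed_vector + banach

instantiation complex :: complex_banach
begin

definition scaleC_complex :: "complex \<Rightarrow> complex \<Rightarrow> complex" where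
  "scaleC_complex a x = a * x"

instance
  by standard (auto simp: scaleC_complex_def algebra_simps scaleR_conv_of_real norm_mult)

end

definition frechet_holomorphic_on ::
    "('e::complex_normed_vector \<Rightarrow> 'f::complex_normed_vector) \<Rightarrow> 'e set \<Rightarrow> bool" where
  "frechet_holomorphic_on f U \<longleftrightarrow>
     (\<forall>x\<in>U. \<exists>D. (f has_derivative D) (at x) \<and> (\<forall>c h. D (c *\<^sub>C h) = c *\<^sub>C D h))"

definition weight_on :: "'e::topological_space set \<Rightarrow> ('e \<Rightarrow> real) \<Rightarrow> bool" where
  "weight_on U v \<longleftrightarrow> continuous_on U v \<and> (\<forall>x\<in>U. 0 < v x)"

text \<open>All norms take values in \<^typ>\<open>ennreal\<close>, so that suprema over empty sets are 0, infima
  over empty sets are \<open>\<infinity>\<close>, and membership in a space is finiteness of its norm.\<close>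

definition weighted_norm ::
    "('e \<Rightarrow> real) \<Rightarrow> 'e set \<Rightarrow> ('e \<Rightarrow> 'f::real_normed_vector) \<Rightarrow> ennreal" where
  "weighted_norm v U f = (SUP x\<in>U. ennreal (v x * norm (f x)))"

text \<open>A mapping on \<open>U\<close> is represented by the total function that extends it by 0, so that
  elements of the space are equal iff they agree on \<open>U\<close>.\<close>

definition weighted_holo ::
    "('e \<Rightarrow> real) \<Rightarrow> 'e set \<Rightarrow> ('e::complex_banach \<Rightarrow> 'f::complex_banach) set" where
  "weighted_holo v U =
     {f. frechet_holomorphic_on f U \<and> (\<forall>x. x \<notin> U \<longrightarrow> f x = 0) \<and> weighted_norm v U f < \<infinity>}"

definition conj_exponent :: "real \<Rightarrow> ennreal" where
  "conj_exponent p = (if p = 1 then \<infinity> else ennreal (p / (p - 1)))"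

definition lq_norm :: "ennreal \<Rightarrow> (nat \<Rightarrow> 'a::real_normed_vector) \<Rightarrow> ennreal" where
  "lq_norm q x =
     (if q = \<infinity> then (SUP n. ennreal (norm (x n)))
      else if summable (\<lambda>n. norm (x n) powr enn2real q)
      then ennreal ((\<Sum>n. norm (x n) powr enn2real q) powr (1 / enn2real q))
      else \<infinity>)"

definition lq_space :: "ennreal \<Rightarrow> (nat \<Rightarrow> 'a::real_normed_vector) set" where
  "lq_space q = {x. lq_norm q x < \<infinity>}"

text \<open>Closed unit ball of the dual of a normed space \<open>X\<close> of scalar functions with norm \<open>N\<close>.
  Functionals are total functions whose values outside \<open>X\<close> are irrelevant.\<close>

definition dual_ball ::
    "('e \<Rightarrow> complex) set \<Rightarrow> (('e \<Rightarrow> complex) \<Rightarrow> ennreal) \<Rightarrow> (('e \<Rightarrow> complex) \<Rightarrow> complex) set" where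
  "dual_ball X N =
     {\<phi>. (\<forall>g\<in>X. \<forall>h\<in>X. \<phi> (\<lambda>x. g x + h x) = \<phi> g + \<phi> h) \<and>
          (\<forall>c. \<forall>g\<in>X. \<phi> (\<lambda>x. c * g x) = c * \<phi> g) \<and>
          (\<forall>g\<in>X. ennreal (cmod (\<phi> g)) \<le> N g)}"

definition weak_lq_norm ::
    "ennreal \<Rightarrow> ('e \<Rightarrow> complex) set \<Rightarrow> (('e \<Rightarrow> complex) \<Rightarrow> ennreal) \<Rightarrow> (nat \<Rightarrow> 'e \<Rightarrow> complex) \<Rightarrow> ennreal"
  where "weak_lq_norm q X N g = (SUP \<phi>\<in>dual_ball X N. lq_norm q (\<lambda>n. \<phi> (g n)))"

definition weak_lq_space ::
    "ennreal \<Rightarrow> ('e \<Rightarrow> complex) set \<Rightarrow> (('e \<Rightarrow> complex) \<Rightarrow> ennreal) \<Rightarrow> (nat \<Rightarrow> 'e \<Rightarrow> complex) set" where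
  "weak_lq_space q X N = {g. (\<forall>n. g n \<in> X) \<and> weak_lq_norm q X N g < \<infinity>}"

definition nuclear_rep ::
    "real \<Rightarrow> ('e \<Rightarrow> real) \<Rightarrow> 'e set \<Rightarrow> ('e::complex_banach \<Rightarrow> 'f::complex_banach) \<Rightarrow>
     (nat \<Rightarrow> 'e \<Rightarrow> complex) \<Rightarrow> (nat \<Rightarrow> 'f) \<Rightarrow> bool" where
  "nuclear_rep p v U f g y \<longleftrightarrow>
     g \<in> weak_lq_space (conj_exponent p) (weighted_holo v U) (weighted_norm v U) \<and>
     y \<in> lq_space (ennreal p) \<and>
     (\<lambda>N. weighted_norm v U (\<lambda>x. f x - (\<Sum>n<N. g n x *\<^sub>C y n))) \<longlonglongrightarrow> 0"

definition right_nuclear ::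
    "real \<Rightarrow> ('e \<Rightarrow> real) \<Rightarrow> 'e set \<Rightarrow> ('e::complex_banach \<Rightarrow> 'f::complex_banach) set" where
  "right_nuclear p v U = {f \<in> weighted_holo v U. \<exists>g y. nuclear_rep p v U f g y}"

definition right_nuclear_norm ::
    "real \<Rightarrow> ('e \<Rightarrow> real) \<Rightarrow> 'e set \<Rightarrow> ('e::complex_banach \<Rightarrow> 'f::complex_banach) \<Rightarrow> ennreal" where
  "right_nuclear_norm p v U f =
     Inf {weak_lq_norm (conj_exponent p) (weighted_holo v U) (weighted_norm v U) g
            * lq_norm (ennreal p) y | g y. nuclear_rep p v U f g y}"

definition pconv_coeffs :: "real \<Rightarrow> (nat \<Rightarrow> complex) set" where
  "pconv_coeffs p =
     (if p = 1 then {a. a \<longlonglongrightarrow> 0 \<and> lq_norm \<infinity> a \<le> 1}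
      else {a. lq_norm (conj_exponent p) a \<le> 1})"

definition pconv :: "real \<Rightarrow> (nat \<Rightarrow> 'f::complex_banach) \<Rightarrow> 'f set" where
  "pconv p x = {z. \<exists>a\<in>pconv_coeffs p. (\<lambda>n. a n *\<^sub>C x n) sums z}"

definition relatively_pcompact :: "real \<Rightarrow> 'f::complex_banach set \<Rightarrow> bool" where
  "relatively_pcompact p K \<longleftrightarrow> (\<exists>x\<in>lq_space (ennreal p). K \<subseteq> pconv p x)"

definition pcompact_measure :: "real \<Rightarrow> 'f::complex_banach set \<Rightarrow> ennreal" where
  "pcompact_measure p K = Inf {lq_norm (ennreal p) x | x. x \<in> lq_space (ennreal p) \<and> K \<subseteq> pconv p x}"

definition pcompact_holo ::
    "real \<Rightarrow> ('e \<Rightarrow> real) \<Rightarrow> 'e set \<Rightarrow> ('e::complex_banach \<Rightarrow> 'f::complex_banach) set" where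
  "pcompact_holo p v U =
     {f \<in> weighted_holo v U. relatively_pcompact p ((\<lambda>x. v x *\<^sub>R f x) ` U)}"

definition pcompact_holo_norm ::
    "real \<Rightarrow> ('e \<Rightarrow> real) \<Rightarrow> 'e set \<Rightarrow> ('e::complex_banach \<Rightarrow> 'f::complex_banach) \<Rightarrow> ennreal" where
  "pcompact_holo_norm p v U f = pcompact_measure p ((\<lambda>x. v x *\<^sub>R f x) ` U)"

end

theory Submission imports Defs
begin

text \<open>Since \<open>v x\<close> times evaluation at \<open>x \<in> U\<close> is a functional in the dual unit ball of the
  weighted space, every coefficient sequence \<open>(v x g\<^sub>n(x))\<^sub>n\<close> of \<open>v x f(x) = \<Sum>\<^sub>n v x g\<^sub>n(x) y\<^sub>n\<close>
  has \<open>p\<^sup>*\<close>-norm at most \<open>w = \<parallel>(g\<^sub>n)\<parallel>\<close>, so the image of \<open>v f\<close> lies in the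
  \<open>p\<close>-convex hull of \<open>(w y\<^sub>n)\<close>. For \<open>p = 1\<close> the coefficients are only bounded while a null sequence
  is needed; there one factors \<open>y\<^sub>n = \<beta>\<^sub>n (y\<^sub>n / \<beta>\<^sub>n)\<close> with \<open>\<beta>\<^sub>n \<rightarrow> 0\<close> so slowly that
  \<open>\<Sum>\<^sub>n \<parallel>y\<^sub>n\<parallel> / \<beta>\<^sub>n\<close> exceeds \<open>\<Sum>\<^sub>n \<parallel>y\<^sub>n\<parallel>\<close> by as little as desired.\<close>

section \<open>Sequence norms and slowly vanishing divisors\<close>

lemma lq_norm_scaleR:
  fixes a :: "nat \<Rightarrow> 'a::real_normed_vector"
  assumes "0 < q" "0 \<le> c"
  shows "lq_norm q (\<lambda>n. c *\<^sub>R a n) = ennreal c * lq_norm q a"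
proof (cases "q = \<infinity>")
  case True
  then show ?thesis
    using assms by (simp add: lq_norm_def ennreal_mult SUP_mult_left_ennreal)
next
  case False
  define r where "r = enn2real q"
  have r: "0 < r"
    using assms False by (simp add: r_def enn2real_positive_iff less_top)
  show ?thesis
  \<comment> \<open>Scaling by 0 makes every sequence summable, so the two summability conditions
    are equivalent only for nonzero \<open>c\<close>. At \<open>c = 0\<close> both sides vanish, as
    \<open>0 * \<infinity> = 0\<close> in \<open>ennreal\<close>.\<close>
  proof (cases "c = 0")
    case True
    then show ?thesis using False by (simp add: lq_norm_def)
  next
    case c: False
    have eq: "norm (c *\<^sub>R a n) powr r = c powr r * norm (a n) powr r" for n
      using assms by (simp add: powr_mult)
    show ?thesis
    proof (cases "summable (\<lambda>n. norm (a n) powr r)")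
      case True
      have "(\<Sum>n. c powr r * norm (a n) powr r) powr (1 / r)
          = c * (\<Sum>n. norm (a n) powr r) powr (1 / r)"
        using True assms r by (simp add: suminf_mult powr_mult powr_powr suminf_nonneg)
      then show ?thesis
        using True False assms
        by (simp add: lq_norm_def eq summable_mult ennreal_mult del: norm_scaleR flip: r_def)
    next
      case nsum: False
      then have "\<not> summable (\<lambda>n. norm (c *\<^sub>R a n) powr r)"
        unfolding eq using c by (simp add: summable_cmult_iff)
      then show ?thesis
        using nsum False assms c by (simp add: lq_norm_def ennreal_mult_top flip: r_def)
    qed
  qed
qed

lemma lq_norm_one:
  fixes y :: "nat \<Rightarrow> 'a::real_normed_vector"
  shows "lq_norm 1 y = (if summable (\<lambda>n. norm (y n)) then ennreal (\<Sum>n. norm (y n)) else \<infinity>)"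
  by (auto simp: lq_norm_def suminf_nonneg)

text \<open>Dividing the terms of a convergent positive series by the square roots of its tails
  gives terms dominated by a telescoping series, hence again a convergent one. The tails tend to 0,
  so a multiple of their roots, capped at 1, serves as \<open>b\<close>.\<close>

lemma summable_divide_null_sequence:
  fixes t :: "nat \<Rightarrow> real"
  assumes t: "\<And>n. 0 \<le> t n" "summable t" and "0 < e"
  obtains b where "\<And>n. 0 < b n" "\<And>n. b n \<le> 1" "b \<longlonglongrightarrow> 0"
    "summable (\<lambda>n. t n / b n)" "(\<Sum>n. t n / b n) \<le> (\<Sum>n. t n) + e"
proof -
  \<comment> \<open>The geometric perturbation keeps all tails \<open>r n\<close> strictly positive.\<close>
  define s where "s n = t n + (1/2)^n" for n
  have s: "summable s" and spos: "0 < s n" for n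
    unfolding s_def using t by (auto intro!: summable_add add_nonneg_pos)
  define r where "r n = (\<Sum>k. s (k + n))" for n
  have rpos: "0 < r n" for n
    unfolding r_def using s spos by (intro suminf_pos) (auto simp: summable_iff_shift)
  have step: "r n = s n + r (Suc n)" for n
    using suminf_split_initial_segment[of "\<lambda>k. s (k + n)" 1] s
    by (simp add: r_def summable_iff_shift)
  have r0: "r \<longlonglongrightarrow> 0"
    unfolding r_def using suminf_exist_split2[OF s] by simp
  \<comment> \<open>This makes the telescoping total \<open>2 * sqrt (r 0) / C\<close> equal to
    \<open>e\<close>.\<close>
  define C where "C = 2 * sqrt (r 0) / e"
  have C: "0 < C" using rpos \<open>0 < e\<close> by (simp add: C_def)
  define b where "b n = min 1 (C * sqrt (r n))" for n
  have telescope: "(\<lambda>n. 2 * (sqrt (r n) - sqrt (r (Suc n))) / C) sums (2 * (sqrt (r 0) - 0) / C)"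
    using r0 tendsto_real_sqrt[OF r0]
    by (intro sums_divide sums_mult telescope_sums') simp
  have tail: "t n / sqrt (r n) \<le> 2 * (sqrt (r n) - sqrt (r (Suc n)))" for n
  proof -
    have "t n \<le> s n" by (simp add: s_def)
    \<comment> \<open>\<open>s n\<close> is the difference of consecutive tails, factored as a
      difference of squares of their roots.\<close>
    also have "s n = (sqrt (r n) - sqrt (r (Suc n))) * (sqrt (r n) + sqrt (r (Suc n)))"
      using step[of n] rpos[of n] rpos[of "Suc n"] by (simp add: algebra_simps)
    also have "\<dots> \<le> (sqrt (r n) - sqrt (r (Suc n))) * (2 * sqrt (r n))"
      using step[of n] spos[of n] by (intro mult_left_mono) auto
    finally show ?thesis using rpos[of n] by (simp add: field_simps)
  qed
  have bound: "t n / b n \<le> t n + 2 * (sqrt (r n) - sqrt (r (Suc n))) / C" for n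
  proof -
    \<comment> \<open>Dividing by a minimum gives the larger of two nonnegative quotients, hence at
      most their sum.\<close>
    have "t n / b n \<le> t n + t n / (C * sqrt (r n))"
      using t(1)[of n] C rpos[of n] by (auto simp: b_def min_def)
    moreover have "t n / (C * sqrt (r n)) = (t n / sqrt (r n)) / C" by simp
    ultimately show ?thesis
      using divide_right_mono[OF tail[of n], of C] C by linarith
  qed
  have sums: "(\<lambda>n. t n + 2 * (sqrt (r n) - sqrt (r (Suc n))) / C) sums ((\<Sum>n. t n) + e)"
    using sums_add[OF summable_sums[OF t(2)] telescope] rpos[of 0] \<open>0 < e\<close> by (simp add: C_def)
  have bpos: "0 < b n" for n using C rpos[of n] by (simp add: b_def)
  have summable: "summable (\<lambda>n. t n / b n)"
    by (rule summable_comparison_test'[OF sums_summable[OF sums], of 0])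
      (use bound t bpos in \<open>simp add: less_imp_le\<close>)
  show thesis
  proof (rule that[of b])
    have "(\<lambda>n. min 1 (C * sqrt (r n))) \<longlonglongrightarrow> min 1 (C * sqrt 0)"
      by (intro tendsto_intros r0)
    then show "b \<longlonglongrightarrow> 0" by (simp add: b_def[abs_def])
    show "(\<Sum>n. t n / b n) \<le> (\<Sum>n. t n) + e"
      using suminf_le[OF bound summable sums_summable[OF sums]] sums_unique[OF sums] by simp
  qed (use bpos summable in \<open>auto simp: b_def\<close>)
qed

section \<open>Complex scalars and p-convex hulls\<close>

lemma scaleC_zero_left [simp]: "0 *\<^sub>C x = 0"
  using norm_scaleC[of 0 x] by simp

lemma scaleR_scaleC: "r *\<^sub>R (a *\<^sub>C x) = (complex_of_real r * a) *\<^sub>C x"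
  by (simp add: scaleC_scaleC flip: scaleC_of_real)

lemma scaleC_scaleR: "a *\<^sub>C (r *\<^sub>R x) = (a * complex_of_real r) *\<^sub>C x"
  by (simp add: scaleC_scaleC flip: scaleC_of_real)

lemma pconvI: "(\<lambda>n. a n *\<^sub>C x n) sums z \<Longrightarrow> a \<in> pconv_coeffs p \<Longrightarrow> z \<in> pconv p x"
  by (auto simp: pconv_def)

text \<open>The bound \<open>w\<close> moves from the coefficients onto \<open>y\<close>, which
  leaves coefficients in the unit ball. The sequence \<open>x\<close> is built before any
  \<open>z\<close> is chosen, so it serves all of \<open>K\<close>. The slack \<open>e\<close> pays
  for the divisors \<open>b\<close> when \<open>p = 1\<close>.\<close>

lemma subset_pconv_of_bounded_coeffs:
  fixes y :: "nat \<Rightarrow> 'f::complex_banach"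
  assumes p: "1 \<le> p" and y: "y \<in> lq_space (ennreal p)" and "0 \<le> w" and "0 < e"
    and K: "\<And>z. z \<in> K \<Longrightarrow>
      \<exists>a. lq_norm (conj_exponent p) a \<le> ennreal w \<and> (\<lambda>n. a n *\<^sub>C y n) sums z"
  shows "\<exists>x\<in>lq_space (ennreal p). K \<subseteq> pconv p x \<and>
    lq_norm (ennreal p) x \<le> ennreal w * lq_norm (ennreal p) y + ennreal e"
proof -
  have q: "0 < conj_exponent p"
    using p by (simp add: conj_exponent_def)
  have yfin: "lq_norm (ennreal p) y < \<infinity>" using y by (simp add: lq_space_def)
  \<comment> \<open>As \<open>inverse 0 = 0\<close>, this covers \<open>w = 0\<close> too.\<close>
  have scaled: "lq_norm (conj_exponent p) (\<lambda>n. inverse w *\<^sub>R a n) \<le> 1"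
    if "lq_norm (conj_exponent p) a \<le> ennreal w" for a :: "nat \<Rightarrow> complex"
  proof -
    have "lq_norm (conj_exponent p) (\<lambda>n. inverse w *\<^sub>R a n) \<le> ennreal (inverse w) * ennreal w"
      using that q \<open>0 \<le> w\<close> by (subst lq_norm_scaleR) (auto intro: mult_left_mono)
    also have "\<dots> = ennreal (inverse w * w)"
      using \<open>0 \<le> w\<close> by (simp add: ennreal_mult)
    also have "\<dots> \<le> 1" by (cases "w = 0") auto
    finally show ?thesis .
  qed
  \<comment> \<open>For \<open>w = 0\<close> the product \<open>inverse w * w\<close> is 0, so
    rescaling recovers \<open>a n\<close> only because \<open>a n\<close> is itself 0.\<close>
  have coeff_zero: "a n = 0" if "lq_norm (conj_exponent p) a \<le> ennreal w" "w = 0"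
    for a :: "nat \<Rightarrow> complex" and n
  proof (cases "p = 1")
    case True
    then have "ennreal (norm (a n)) \<le> 0"
      using that SUP_upper[of n UNIV "\<lambda>n. ennreal (norm (a n))"]
      by (simp add: conj_exponent_def lq_norm_def)
    then show ?thesis by simp
  next
    case False
    then have "1 < p" using p by simp
    define r where "r = p / (p - 1)"
    have r: "0 < r" using \<open>1 < p\<close> by (simp add: r_def)
    \<comment> \<open>A divergent series has norm \<open>\<infinity>\<close> by definition, so the
      finite bound yields summability.\<close>
    have sm: "summable (\<lambda>n. norm (a n) powr r)"
      and "ennreal ((\<Sum>n. norm (a n) powr r) powr (1 / r)) \<le> 0"
      using that False r
      by (auto simp: conj_exponent_def lq_norm_def top_unique simp flip: r_def split: if_splits)
    then have "(\<Sum>n. norm (a n) powr r) = 0" by simp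
    then have "norm (a n) powr r = 0"
      using suminf_eq_zero_iff[OF sm] by simp
    then show ?thesis by simp
  qed
  show ?thesis
  proof (cases "p = 1")
    case False
    let ?x = "\<lambda>n. w *\<^sub>R y n"
    have norm_x: "lq_norm (ennreal p) ?x = ennreal w * lq_norm (ennreal p) y"
      using p \<open>0 \<le> w\<close> by (intro lq_norm_scaleR) auto
    have "K \<subseteq> pconv p ?x"
    proof
      fix z assume "z \<in> K"
      with K obtain a where a: "lq_norm (conj_exponent p) a \<le> ennreal w"
        "(\<lambda>n. a n *\<^sub>C y n) sums z" by blast
      have coeff: "(inverse w *\<^sub>R a n) * complex_of_real w = a n" for n
        using coeff_zero[OF a(1), of n] by (cases "w = 0") (auto simp: scaleR_conv_of_real)
      have "(inverse w *\<^sub>R a n) *\<^sub>C ?x n = a n *\<^sub>C y n" for n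
        by (simp only: scaleC_scaleR coeff)
      then have "(\<lambda>n. (inverse w *\<^sub>R a n) *\<^sub>C ?x n) sums z"
        using a(2) by (simp only:)
      moreover have "(\<lambda>n. inverse w *\<^sub>R a n) \<in> pconv_coeffs p"
        using scaled[OF a(1)] False by (simp add: pconv_coeffs_def)
      ultimately show "z \<in> pconv p ?x" by (rule pconvI)
    qed
    moreover have "?x \<in> lq_space (ennreal p)"
      using norm_x yfin by (simp add: lq_space_def ennreal_mult_less_top)
    ultimately show ?thesis using norm_x by (intro bexI[of _ ?x]) auto
  next
    case True
    have sy: "summable (\<lambda>n. norm (y n))"
      and norm_y: "lq_norm 1 y = ennreal (\<Sum>n. norm (y n))"
      using yfin True by (auto simp: lq_norm_one split: if_splits)
    \<comment> \<open>With \<open>w + 1\<close> the quotient stays positive at \<open>w = 0\<close>,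
      and \<open>w\<close> times it is at most \<open>e\<close>.\<close>
    have "0 < e / (w + 1)" using \<open>0 \<le> w\<close> \<open>0 < e\<close> by simp
    then obtain b where b: "\<And>n. 0 < b n" "\<And>n. b n \<le> 1" "b \<longlonglongrightarrow> 0"
      and sb: "summable (\<lambda>n. norm (y n) / b n)"
      and le: "(\<Sum>n. norm (y n) / b n) \<le> (\<Sum>n. norm (y n)) + e / (w + 1)"
      by (rule summable_divide_null_sequence[OF norm_ge_zero sy]) blast
    let ?x = "\<lambda>n. (w / b n) *\<^sub>R y n"
    have norm_eq: "norm (?x n) = w * (norm (y n) / b n)" for n
      using \<open>0 \<le> w\<close> b(1)[of n] by simp
    have "lq_norm 1 ?x = ennreal (w * (\<Sum>n. norm (y n) / b n))"
      unfolding lq_norm_one norm_eq using sb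
      by (simp add: summable_mult suminf_mult del: times_divide_eq_right)
    also have "\<dots> \<le> ennreal (w * (\<Sum>n. norm (y n)) + e)"
    proof (rule ennreal_leI)
      have "w * (\<Sum>n. norm (y n) / b n) \<le> w * (\<Sum>n. norm (y n)) + w * (e / (w + 1))"
        using mult_left_mono[OF le \<open>0 \<le> w\<close>] by (simp add: distrib_left)
      also have "w * (e / (w + 1)) \<le> e"
        using \<open>0 \<le> w\<close> \<open>0 < e\<close> by (simp add: field_simps)
      finally show "w * (\<Sum>n. norm (y n) / b n) \<le> w * (\<Sum>n. norm (y n)) + e" by simp
    qed
    also have "\<dots> = ennreal w * lq_norm 1 y + ennreal e"
      using \<open>0 \<le> w\<close> \<open>0 < e\<close> sy by (simp add: norm_y ennreal_mult suminf_nonneg)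
    finally have norm_x: "lq_norm 1 ?x \<le> ennreal w * lq_norm 1 y + ennreal e" .
    have "K \<subseteq> pconv 1 ?x"
    proof
      fix z assume "z \<in> K"
      with K obtain a where a: "lq_norm (conj_exponent p) a \<le> ennreal w"
        "(\<lambda>n. a n *\<^sub>C y n) sums z" by blast
      \<comment> \<open>The factor \<open>b n\<close> cancels the divisor in \<open>?x\<close> and
        turns coefficients bounded by 1 into a null sequence.\<close>
      let ?c = "\<lambda>n. b n *\<^sub>R (inverse w *\<^sub>R a n)"
      have "(SUP n. ennreal (norm (inverse w *\<^sub>R a n))) \<le> 1"
        using scaled[OF a(1)] True by (simp add: conj_exponent_def lq_norm_def)
      then have "ennreal (norm (inverse w *\<^sub>R a n)) \<le> 1" for n
        by (rule order_trans[OF SUP_upper[OF UNIV_I]])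
      then have bnd: "norm (inverse w *\<^sub>R a n) \<le> 1" for n
        by (simp del: norm_scaleR)
      have c_le: "norm (?c n) \<le> b n" for n
        unfolding norm_scaleR[of "b n"]
        using mult_left_mono[OF bnd[of n], of "b n"] b(1)[of n] by simp
      have "?c \<longlonglongrightarrow> 0"
        by (rule Lim_null_comparison[OF always_eventually[OF allI[OF c_le]] b(3)])
      moreover have "lq_norm \<infinity> ?c \<le> 1"
        unfolding lq_norm_def using order_trans[OF c_le b(2)]
        by (simp add: SUP_le_iff del: norm_scaleR)
      ultimately have c: "?c \<in> pconv_coeffs 1" by (simp add: pconv_coeffs_def)
      have coeff: "?c n * complex_of_real (w / b n) = a n" for n
        using coeff_zero[OF a(1), of n] b(1)[of n]
        by (cases "w = 0") (auto simp: scaleR_conv_of_real)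
      have "?c n *\<^sub>C ?x n = a n *\<^sub>C y n" for n
        by (simp only: scaleC_scaleR coeff)
      then have "(\<lambda>n. ?c n *\<^sub>C ?x n) sums z"
        using a(2) by (simp only:)
      then show "z \<in> pconv 1 ?x" using c by (rule pconvI)
    qed
    moreover have "?x \<in> lq_space 1"
      unfolding lq_space_def using le_less_trans[OF norm_x] yfin True
      by (simp add: ennreal_mult_less_top)
    ultimately show ?thesis using norm_x True by (intro bexI[of _ ?x]) auto
  qed
qed

section \<open>Weighted evaluation and nuclear representations\<close>

lemma weighted_evaluation_in_dual_ball:
  assumes "x \<in> U" "0 \<le> v x"
  shows "(\<lambda>g. complex_of_real (v x) * g x) \<in> dual_ball X (weighted_norm v U)"
  using assms
  by (auto simp: dual_ball_def weighted_norm_def algebra_simps norm_mult intro!: SUP_upper2[of x])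

text \<open>At a point of \<open>U\<close> the error of a partial sum, multiplied by
  \<open>v x\<close>, is at most the weighted norm of the error, which tends to 0.\<close>

lemma nuclear_rep_sums:
  assumes rep: "nuclear_rep p v U f g y" and x: "x \<in> U" "0 < v x"
  shows "(\<lambda>n. (complex_of_real (v x) * g n x) *\<^sub>C y n) sums (v x *\<^sub>R f x)"
proof -
  let ?d = "\<lambda>N. v x *\<^sub>R f x - (\<Sum>n<N. (complex_of_real (v x) * g n x) *\<^sub>C y n)"
  have d: "?d N = v x *\<^sub>R (f x - (\<Sum>n<N. g n x *\<^sub>C y n))" for N
    by (simp add: scaleR_diff_right scaleR_sum_right scaleR_scaleC)
  have "(\<lambda>N. ennreal (norm (?d N))) \<longlonglongrightarrow> ennreal 0"
  proof (rule tendsto_sandwich[OF _ _ tendsto_const])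
    show "(\<lambda>N. weighted_norm v U (\<lambda>x. f x - (\<Sum>n<N. g n x *\<^sub>C y n))) \<longlonglongrightarrow> ennreal 0"
      using rep by (simp add: nuclear_rep_def)
    show "\<forall>\<^sub>F N in sequentially. ennreal (norm (?d N))
        \<le> weighted_norm v U (\<lambda>x. f x - (\<Sum>n<N. g n x *\<^sub>C y n))"
      unfolding d weighted_norm_def using x by (auto intro!: always_eventually SUP_upper2[of x])
  qed auto
  then have "(\<lambda>N. norm (?d N)) \<longlonglongrightarrow> 0"
    by (subst (asm) tendsto_ennreal_iff) auto
  then have "?d \<longlonglongrightarrow> 0" by (rule tendsto_norm_zero_cancel)
  then show ?thesis
    unfolding sums_def using tendsto_diff[OF tendsto_const, of ?d 0 sequentially "v x *\<^sub>R f x"] by simp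
qed

lemma nuclear_rep_pcompact:
  assumes p: "1 \<le> p" and v: "weight_on U v" and rep: "nuclear_rep p v U f g y" and "0 < e"
  shows "\<exists>x\<in>lq_space (ennreal p). (\<lambda>x. v x *\<^sub>R f x) ` U \<subseteq> pconv p x \<and> lq_norm (ennreal p) x
    \<le> weak_lq_norm (conj_exponent p) (weighted_holo v U) (weighted_norm v U) g
        * lq_norm (ennreal p) y + ennreal e"
proof -
  let ?W = "weak_lq_norm (conj_exponent p) (weighted_holo v U) (weighted_norm v U) g"
  have "?W < \<infinity>" and y: "y \<in> lq_space (ennreal p)"
    using rep by (auto simp: nuclear_rep_def weak_lq_space_def)
  \<comment> \<open>Finiteness of the weak norm lets it play the role of the real bound
    \<open>w\<close>.\<close>
  then have W: "?W = ennreal (enn2real ?W)" by simp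
  have coeff: "\<exists>a. lq_norm (conj_exponent p) a \<le> ?W \<and> (\<lambda>n. a n *\<^sub>C y n) sums z"
    if z: "z \<in> (\<lambda>x. v x *\<^sub>R f x) ` U" for z
  proof -
    obtain x where x: "x \<in> U" "z = v x *\<^sub>R f x" using z by blast
    then have "0 < v x" using v by (simp add: weight_on_def)
    \<comment> \<open>Weighted evaluation at \<open>x\<close> contributes one of the terms of the
      supremum defining \<open>?W\<close>.\<close>
    moreover have "lq_norm (conj_exponent p) (\<lambda>n. complex_of_real (v x) * g n x) \<le> ?W"
      unfolding weak_lq_norm_def
      by (rule SUP_upper2[OF weighted_evaluation_in_dual_ball[of x]])
        (use x \<open>0 < v x\<close> in auto)
    ultimately show ?thesis using nuclear_rep_sums[OF rep x(1)] x(2) by blast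
  qed
  then show ?thesis
    using subset_pconv_of_bounded_coeffs[OF p y enn2real_nonneg \<open>0 < e\<close>, of "(\<lambda>x. v x *\<^sub>R f x) ` U" ?W] W
    by simp
qed

theorem corollary2p30:
  fixes p :: real and U :: "'e::complex_banach set" and v :: "'e \<Rightarrow> real"
  assumes "1 \<le> p" and "open U" and "weight_on U v"
  shows "(right_nuclear p v U :: ('e \<Rightarrow> 'f::complex_banach) set) \<subseteq> pcompact_holo p v U \<and>
    (\<forall>f\<in>(right_nuclear p v U :: ('e \<Rightarrow> 'f) set).
       pcompact_holo_norm p v U f \<le> right_nuclear_norm p v U f)"
proof (intro conjI subsetI ballI)
  fix f :: "'e \<Rightarrow> 'f" assume "f \<in> right_nuclear p v U"
  then obtain g y where f: "f \<in> weighted_holo v U" and rep: "nuclear_rep p v U f g y"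
    by (auto simp: right_nuclear_def)
  \<comment> \<open>Membership needs only some admissible sequence, so the slack can be taken to be
    1.\<close>
  show "f \<in> pcompact_holo p v U"
    using f nuclear_rep_pcompact[OF assms(1,3) rep zero_less_one]
    by (auto simp: pcompact_holo_def relatively_pcompact_def)
next
  fix f :: "'e \<Rightarrow> 'f"
  show "pcompact_holo_norm p v U f \<le> right_nuclear_norm p v U f"
    unfolding right_nuclear_norm_def
  proof (rule Inf_greatest, clarify)
    fix g and y :: "nat \<Rightarrow> 'f" assume rep: "nuclear_rep p v U f g y"
    show "pcompact_holo_norm p v U f
      \<le> weak_lq_norm (conj_exponent p) (weighted_holo v U) (weighted_norm v U) g
          * lq_norm (ennreal p) y"
    \<comment> \<open>For a fixed representation the slack tends to 0; the infimum over
      representations comes afterwards.\<close>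
    proof (rule ennreal_le_epsilon)
      fix e :: real assume "0 < e"
      from nuclear_rep_pcompact[OF assms(1,3) rep this]
      show "pcompact_holo_norm p v U f
        \<le> weak_lq_norm (conj_exponent p) (weighted_holo v U) (weighted_norm v U) g
            * lq_norm (ennreal p) y + ennreal e"
        unfolding pcompact_holo_norm_def pcompact_measure_def by (blast intro: Inf_lower2)
    qed
  qed
qed

end
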